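(* Let $K$ be an integer with $K>4$ and $K$ divisible by $4$. Let $$\Omega=\{(X_1,X_2,X_3)\in(\mathbb{R}^{K\times K})^3:\ X_i\mathbf{1}=\mathbf{1},\ X_i^\top\mathbf{1}=\mathbf{1},\ \mathrm{Tr}(X_i)=0,\ X_i\ge0,\ i=1,2,3\},$$ let $p(Z)=\langle X_1,X_2\rangle+\langle X_1,X_3\rangle+\langle X_2,X_3\rangle$ for $Z=(X_1,X_2,X_3)$, and let $\mathcal{F}=\{Z\in\Omega:\ p(Z)=0\}$. Then there does not exist $\tau>0$ such that $$\mathrm{dist}(Z,\mathcal{F})\le\tau\,p(Z)\quad\text{for all } Z\in\Omega.$$
   Context: Here $\mathbf{1}\in\mathbb{R}^K$ is the all-one vector, $X_i\ge0$ is entrywise, $\langle\cdot,\cdot\rangle$ is the standard (entrywise) inner product of matrices, and $\|\cdot\|$ is the induced (Frobenius) norm on $(\mathbb{R}^{K\times K})^3$, i.e. $\|Z\|^2=\sum_{i=1}^3\langle X_i,X_i\rangle$. For a closed set $S$, $\mathrm{dist}(Z,S)=\min_{W\in S}\|Z-W\|$. *)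

theory Defs
  imports "HOL-Analysis.Analysis"
begin

text \<open>
  Matrices of size K are elements of \<open>real^'k^'k\<close> with \<open>K = CARD('k)\<close>. The library inner
  product of such matrices is the entrywise one, and the product type carries the Euclidean
  product norm, so \<open>norm\<close> and \<open>dist\<close> on triples are the Frobenius norm and distance.
\<close>

type_synonym 'k mat_triple = "(real^'k^'k) \<times> (real^'k^'k) \<times> (real^'k^'k)"

definition zero_trace_ds :: "(real^'k^'k) set" where
  "zero_trace_ds = {X. X *v 1 = 1 \<and> transpose X *v 1 = 1 \<and> trace X = 0 \<and> (\<forall>i j. 0 \<le> X $ i $ j)}"

definition Omega :: "('k::finite) mat_triple set" where
  "Omega = {(X1, X2, X3). X1 \<in> zero_trace_ds \<and> X2 \<in> zero_trace_ds \<and> X3 \<in> zero_trace_ds}"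

definition penalty :: "('k::finite) mat_triple \<Rightarrow> real" where
  "penalty = (\<lambda>(X1, X2, X3). X1 \<bullet> X2 + X1 \<bullet> X3 + X2 \<bullet> X3)"

definition feasible :: "('k::finite) mat_triple set" where
  "feasible = {Z \<in> Omega. penalty Z = 0}"

lemma inner_matrix_entrywise:
  fixes X Y :: "real^'k^'k"
  shows "X \<bullet> Y = (\<Sum>i\<in>UNIV. \<Sum>j\<in>UNIV. X $ i $ j * Y $ i $ j)"
  by (simp add: inner_vec_def)

lemma norm_mat_triple:
  fixes X1 X2 X3 :: "real^'k^'k"
  shows "(norm (X1, X2, X3))\<^sup>2 = X1 \<bullet> X1 + X2 \<bullet> X2 + X3 \<bullet> X3"
  by (simp add: power2_norm_eq_inner)

lemma zero_trace_ds_closed: "closed (zero_trace_ds :: (real^'k^'k) set)"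
  unfolding zero_trace_ds_def trace_def matrix_vector_mult_def transpose_def
  by (intro closed_Collect_conj closed_Collect_all closed_Collect_eq closed_Collect_le
      continuous_intros)

lemma feasible_closed: "closed (feasible :: ('k::finite) mat_triple set)"
proof -
  have eq: "feasible = (zero_trace_ds \<times> zero_trace_ds \<times> zero_trace_ds) \<inter>
      {Z :: 'k mat_triple. fst Z \<bullet> fst (snd Z) + fst Z \<bullet> snd (snd Z) +
         fst (snd Z) \<bullet> snd (snd Z) = 0}"
    by (auto simp: feasible_def Omega_def penalty_def)
  show ?thesis
    unfolding eq
    by (intro closed_Int closed_Times zero_trace_ds_closed closed_Collect_eq continuous_intros)
qed

text \<open>
  On a nonempty closed set the library's \<open>infdist\<close>, an infimum, is an attained minimum.
\<close>

lemma infdist_feasible_attained: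
  fixes Z :: "('k::finite) mat_triple"
  assumes "(feasible :: 'k mat_triple set) \<noteq> {}"
  shows "\<exists>W\<in>feasible. infdist Z feasible = dist Z W \<and> (\<forall>V\<in>feasible. dist Z W \<le> dist Z V)"
  using infdist_attains_inf[OF feasible_closed assms, of Z] infdist_le by metis

end

theory Submission
  imports Defs "HOL-Number_Theory.Cong"
begin

text \<open>
  Since \<open>K \<ge> 5\<close>, there are four pairwise disjoint permutation matrices \<open>P, Q, R, S\<close> with zero
  diagonal (cyclic shifts). For small \<open>\<epsilon>\<close> put \<open>Z = ((1 - \<epsilon>) P + \<epsilon> S, (1 - \<epsilon>) Q + \<epsilon> S, R)\<close>. The first
  two components overlap only on the support of \<open>S\<close>, where both equal \<open>\<epsilon>\<close>, so the penalty is
  \<open>\<epsilon>\<^sup>2 K\<close>. A feasible triple has, at a position in that support, a zero in its first or second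
  component, so its distance from \<open>Z\<close> is at least \<open>\<epsilon>\<close>.
\<close>

definition perm_matrix :: "('k \<Rightarrow> 'k) \<Rightarrow> real^'k^('k::finite)" where
  "perm_matrix f = (\<chi> i j. if j = f i then 1 else 0)"

lemma perm_matrix_nth: "perm_matrix f $ i $ j = (if j = f i then 1 else 0)"
  by (simp add: perm_matrix_def)

text \<open>Row \<open>i\<close> contributes 1 exactly when both matrices have their 1 in the same
  column.\<close>

lemma inner_perm_matrix: "perm_matrix f \<bullet> perm_matrix g = real (card {i. f i = g i})"
proof -
  have "perm_matrix f \<bullet> perm_matrix g = (\<Sum>i\<in>UNIV. if f i = g i then 1 else 0)"
    by (simp add: inner_matrix_entrywise perm_matrix_nth if_distrib[of "\<lambda>x. x * _"] cong: if_cong)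
  then show ?thesis
    by (simp add: sum.If_cases)
qed

lemma zero_trace_ds_iff:
  "X \<in> zero_trace_ds \<longleftrightarrow> (\<forall>i. (\<Sum>j\<in>UNIV. X $ i $ j) = 1) \<and> (\<forall>j. (\<Sum>i\<in>UNIV. X $ i $ j) = 1) \<and>
     (\<Sum>i\<in>UNIV. X $ i $ i) = 0 \<and> (\<forall>i j. 0 \<le> X $ i $ j)"
  by (simp add: zero_trace_ds_def trace_def vec_eq_iff matrix_vector_mult_def transpose_def)

lemma perm_matrix_in_zero_trace_ds:
  assumes "bij f" and "\<And>i. f i \<noteq> i"
  shows "perm_matrix f \<in> zero_trace_ds"
proof -
  have "(\<Sum>i\<in>UNIV. perm_matrix f $ i $ j) = 1" for j
  proof -
    \<comment> \<open>Bijectivity leaves a single nonzero term in each column sum.\<close>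
    have "j = f i \<longleftrightarrow> i = inv f j" for i
      using assms(1) by (metis bij_inv_eq_iff)
    then show ?thesis by (simp add: perm_matrix_nth)
  qed
  moreover have "(\<Sum>i\<in>UNIV. perm_matrix f $ i $ i) = 0"
    using assms(2) by (simp add: perm_matrix_nth eq_commute)
  ultimately show ?thesis
    by (simp add: zero_trace_ds_iff perm_matrix_nth)
qed

lemma convex_zero_trace_ds: "convex zero_trace_ds"
  by (auto simp: convex_def zero_trace_ds_iff sum.distrib simp flip: sum_distrib_left)

text \<open>Entrywise nonnegativity makes every inner product in the penalty nonnegative, so a zero
  total forces each product, and then each summand, to vanish.\<close>

lemma feasible_entry_zero:
  assumes "(Y1, Y2, Y3) \<in> feasible"
  shows "Y1 $ i $ j = 0 \<or> Y2 $ i $ j = 0"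
proof -
  have nn: "0 \<le> Y1 $ a $ b" "0 \<le> Y2 $ a $ b" "0 \<le> Y3 $ a $ b" for a b
    using assms by (auto simp: feasible_def Omega_def zero_trace_ds_iff)
  have "0 \<le> Y1 \<bullet> Y2" "0 \<le> Y1 \<bullet> Y3" "0 \<le> Y2 \<bullet> Y3"
    by (auto simp: inner_matrix_entrywise nn intro!: sum_nonneg)
  moreover have "Y1 \<bullet> Y2 + Y1 \<bullet> Y3 + Y2 \<bullet> Y3 = 0"
    using assms by (simp add: feasible_def penalty_def)
  ultimately have "Y1 \<bullet> Y2 = 0" by linarith
  then have "Y1 $ i $ j * Y2 $ i $ j = 0"
    by (simp add: inner_matrix_entrywise sum_nonneg_eq_0_iff sum_nonneg nn)
  then show ?thesis by simp
qed

lemma le_dist_feasible: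
  fixes X1 X2 X3 :: "real^'k^('k::finite)"
  assumes W: "W \<in> feasible" and X: "e \<le> X1 $ i $ j" "e \<le> X2 $ i $ j"
  shows "e \<le> dist (X1, X2, X3) W"
proof -
  obtain Y1 Y2 Y3 where W_eq: "W = (Y1, Y2, Y3)" by (cases W)
  have entry: "\<bar>A $ i $ j - B $ i $ j\<bar> \<le> dist A B" for A B :: "real^'k^'k"
    using dist_vec_nth_le[of "A $ i" j "B $ i"] dist_vec_nth_le[of A i B]
    by (simp add: dist_real_def)
  have "dist X1 Y1 \<le> dist (X1, X2, X3) W" "dist X2 Y2 \<le> dist (X1, X2, X3) W"
    unfolding W_eq
    using dist_fst_le[of "(X1, X2, X3)" "(Y1, Y2, Y3)"] dist_snd_le[of "(X1, X2, X3)" "(Y1, Y2, Y3)"]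
      dist_fst_le[of "(X2, X3)" "(Y2, Y3)"]
    by auto
  with feasible_entry_zero[OF W[unfolded W_eq], of i j] entry[of X1 Y1] entry[of X2 Y2] X
  show ?thesis by auto
qed

text \<open>Cyclic shifts modulo \<open>CARD('k)\<close>, transported along an enumeration of the
  type. Shift 0 is the identity, so disjointness from it gives the other shifts a zero
  diagonal.\<close>

lemma exists_disjoint_bijections:
  obtains f :: "nat \<Rightarrow> 'k::finite \<Rightarrow> 'k"
  where "\<And>m. bij (f m)" and "\<And>i. f 0 i = i"
    and "\<And>m n i. m < CARD('k) \<Longrightarrow> n < CARD('k) \<Longrightarrow> m \<noteq> n \<Longrightarrow> f m i \<noteq> f n i"
proof -
  let ?K = "CARD('k)"
  obtain h :: "'k \<Rightarrow> nat" where h: "bij_betw h UNIV {0..<?K}"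
    using ex_bij_betw_finite_nat[OF finite_class.finite_UNIV] by blast
  have h_less: "h i < ?K" for i
    using h by (auto simp: bij_betw_def)
  define g where "g = inv_into UNIV h"
  have hg: "h (g (a mod ?K)) = a mod ?K" for a
    unfolding g_def by (rule bij_betw_inv_into_right[OF h]) simp
  define f where "f m i = g ((h i + m) mod ?K)" for m i
  have hf: "h (f m i) = (h i + m) mod ?K" for m i
    by (simp add: f_def hg)
  have inj_h: "inj h"
    using h by (simp add: bij_betw_def)
  \<comment> \<open>Serves twice: \<open>c = m\<close> gives injectivity of one shift,
    \<open>c = h i\<close> disjointness of two.\<close>
  have cancel: "a = b" if "(c + a) mod ?K = (c + b) mod ?K" "a < ?K" "b < ?K" for a b c
    using that by (metis cong_def cong_add_lcancel_nat mod_less)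
  show thesis
  proof
    show "bij (f m)" for m
    proof -
      have "inj (f m)"
      proof (rule injI)
        fix i j assume "f m i = f m j"
        then have "(m + h i) mod ?K = (m + h j) mod ?K"
          by (metis hf add.commute)
        then show "i = j"
          using cancel h_less inj_h by (meson injD)
      qed
      then show ?thesis
        by (simp add: bij_def finite_UNIV_inj_surj)
    qed
    show "f 0 i = i" for i
      using h_less hf[of 0 i] inj_h by (simp add: inj_eq)
    show "f m i \<noteq> f n i" if "m < ?K" "n < ?K" "m \<noteq> n" for m n i
      using that cancel hf by metis
  qed
qed

theorem theorem1:
  assumes "CARD('k::finite) > 4" and "4 dvd CARD('k)"
  shows "\<not> (\<exists>\<tau>>0. \<forall>Z \<in> (Omega :: 'k mat_triple set). infdist Z feasible \<le> \<tau> * penalty Z)"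
proof
  assume "\<exists>\<tau>>0. \<forall>Z \<in> (Omega :: 'k mat_triple set). infdist Z feasible \<le> \<tau> * penalty Z"
  then obtain \<tau> where \<tau>: "\<tau> > 0"
    and bound: "\<And>Z. Z \<in> (Omega :: 'k mat_triple set) \<Longrightarrow> infdist Z feasible \<le> \<tau> * penalty Z"
    by blast
  obtain f :: "nat \<Rightarrow> 'k \<Rightarrow> 'k" where bij: "\<And>m. bij (f m)" and f0: "\<And>i. f 0 i = i"
    and disj: "\<And>m n i. m < CARD('k) \<Longrightarrow> n < CARD('k) \<Longrightarrow> m \<noteq> n \<Longrightarrow> f m i \<noteq> f n i"
    using exists_disjoint_bijections by blast
  define P where "P m = perm_matrix (f m)" for m
  have P_ds: "P m \<in> zero_trace_ds" if "0 < m" "m \<le> 4" for m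
    unfolding P_def using disj[of m 0] f0 that assms(1)
    by (intro perm_matrix_in_zero_trace_ds bij) auto
  have orth: "P m \<bullet> P n = 0" if "m \<le> 4" "n \<le> 4" "m \<noteq> n" for m n
    unfolding P_def inner_perm_matrix using disj[of m n] that assms(1) by simp
  have self: "P m \<bullet> P m = CARD('k)" for m
    by (simp add: P_def inner_perm_matrix)
  \<comment> \<open>A feasible point is needed since \<open>infdist\<close> to the empty set is 0 by
    convention.\<close>
  have "(P 1, P 2, P 3) \<in> feasible"
    by (simp add: feasible_def Omega_def penalty_def P_ds orth)
  then have ne: "(feasible :: 'k mat_triple set) \<noteq> {}" by blast

  \<comment> \<open>The cap 1 keeps the mixtures convex; the other bound gives
    \<open>\<tau> * penalty Z\<close> \<le> \<open>e / 2\<close>, below the distance bound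
    \<open>e\<close>.\<close>
  define e where "e = min 1 (1 / (2 * \<tau> * CARD('k)))"
  have e: "0 < e" "e \<le> 1" and e_le: "e * (2 * \<tau> * CARD('k)) \<le> 1"
    using \<tau> by (auto simp: e_def min_def field_simps)
  define Z where "Z = ((1 - e) *\<^sub>R P 1 + e *\<^sub>R P 4, (1 - e) *\<^sub>R P 2 + e *\<^sub>R P 4, P 3)"
  have Z_Omega: "Z \<in> Omega"
    using e by (auto simp: Z_def Omega_def P_ds intro!: convexD[OF convex_zero_trace_ds])
  have pen: "penalty Z = e * e * CARD('k)"
    by (simp add: Z_def penalty_def inner_add_left inner_add_right orth self)
  \<comment> \<open>The row \<open>undefined\<close> is arbitrary; column
    \<open>f 4 undefined\<close> puts the entry in the support of \<open>P 4\<close>, where both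
    mixtures are at least \<open>e\<close>.\<close>
  have "e \<le> dist Z W" if "W \<in> feasible" for W
    unfolding Z_def
    by (rule le_dist_feasible[OF that, of _ _ undefined "f 4 undefined"])
      (use e in \<open>auto simp: P_def perm_matrix_nth\<close>)
  then have "e \<le> infdist Z feasible"
    using infdist_feasible_attained[OF ne, of Z] by auto
  also have "\<dots> \<le> \<tau> * (e * e * CARD('k))"
    using bound[OF Z_Omega] pen by simp
  also have "\<dots> = e * (e * (2 * \<tau> * CARD('k))) / 2"
    by simp
  also have "\<dots> \<le> e * 1 / 2"
    using e e_le by (intro divide_right_mono mult_left_mono) auto
  finally show False using e by simp
qed

end
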